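(* Let $\mathcal{G}=(V,E)$ be a finite connected undirected graph with $|V|\ge 2$, conductances $c:E\to\mathbb{R}_{>0}$ and a marked vertex $b\in V$. Let $\Sigma$ be the floating component of a $\mathbb{P}$-random two-component spanning forest of $\mathcal{G}$. For every edge $e\in E$, the probability that $e$ connects $\Sigma$ to $\Sigma^c=V\setminus\Sigma$ is $$\mathbb{P}(e\in\partial\Sigma)=\frac{\kappa\,T(e,e)}{c(e)\,\kappa_2}.$$
   Context: A spanning tree of $\mathcal{G}$ is a connected acyclic subgraph $(V,A)$, $A\subseteq E$. A two-component spanning forest (2SF) is an acyclic subgraph $(V,B)$, $B\subseteq E$, with exactly two connected components (a component may be a single vertex). The weight of a subgraph is the product of the conductances $c(e)$ of its edges. $\kappa$ is the sum of the weights of all spanning trees of $\mathcal{G}$, and $\kappa_2$ is the sum of the weights of all 2SFs of $\mathcal{G}$. $\mathbb{P}$ is the probability measure on 2SFs giving each 2SF probability proportional to its weight. The floating component of a 2SF is (the vertex set of) the component not containing $b$. $\partial\Sigma$ is the set of edges of $\mathcal{G}$ with exactly one endpoint in $\Sigma$. The Laplacian is $\Delta f(v)=\sum_{v'\sim v}c_{vv'}(f(v)-f(v'))$ on $\mathbb{R}^V$. The Dirichlet Laplacian $\Delta_D$ on $\mathbb{R}^{V\setminus\{b\}}$ is the matrix obtained from $\Delta$ by deleting the row and column of $b$; it is invertible. The Green's function is $G=\Delta_D^{-1}$, extended by $G(u,v)=0$ if $u=b$ or $v=b$. For directed edges $e=u_1v_1$, $e'=u_2v_2$ the transfer current is $T(e,e')=c(e')\big(G(u_1,u_2)-G(u_1,v_2)-G(u_2,v_1)+G(v_1,v_2)\big)$;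 $T(e,e)$ does not depend on the orientation of $e$. *)

theory Defs
  imports "HOL-Probability.Probability"
begin

text \<open>A graph is a pair of a vertex set and a set of edges, an edge being a two-element set of
  vertices. All subgraphs considered are spanning, i.e. of the form \<open>(V, A)\<close> with \<open>A \<subseteq> E\<close>.\<close>

definition simple_graph :: "'a set \<Rightarrow> 'a set set \<Rightarrow> bool" where
  "simple_graph V E \<longleftrightarrow> finite V \<and> (\<forall>e\<in>E. e \<subseteq> V \<and> card e = 2)"

definition adj :: "'a set set \<Rightarrow> ('a \<times> 'a) set" where
  "adj A = {(u, v). {u, v} \<in> A}"

definition graph_connected :: "'a set \<Rightarrow> 'a set set \<Rightarrow> bool" where
  "graph_connected V A \<longleftrightarrow> V \<noteq> {} \<and> (\<forall>u\<in>V. \<forall>v\<in>V. (u, v) \<in> (adj A)\<^sup>*)"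

definition graph_components :: "'a set \<Rightarrow> 'a set set \<Rightarrow> 'a set set" where
  "graph_components V A = V // {(u, v). u \<in> V \<and> v \<in> V \<and> (u, v) \<in> (adj A)\<^sup>*}"

definition is_cycle :: "'a set set \<Rightarrow> 'a list \<Rightarrow> bool" where
  "is_cycle A xs \<longleftrightarrow> length xs \<ge> 3 \<and> distinct xs \<and>
     (\<forall>i < length xs. {xs ! i, xs ! (Suc i mod length xs)} \<in> A)"

definition acyclic_edges :: "'a set set \<Rightarrow> bool" where
  "acyclic_edges A \<longleftrightarrow> (\<nexists>xs. is_cycle A xs)"

definition spanning_trees :: "'a set \<Rightarrow> 'a set set \<Rightarrow> 'a set set set" where
  "spanning_trees V E = {A. A \<subseteq> E \<and> graph_connected V A \<and> acyclic_edges A}"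

definition two_forests :: "'a set \<Rightarrow> 'a set set \<Rightarrow> 'a set set set" where
  "two_forests V E = {B. B \<subseteq> E \<and> acyclic_edges B \<and> card (graph_components V B) = 2}"

definition edge_boundary :: "'a set set \<Rightarrow> 'a set \<Rightarrow> 'a set set" where
  "edge_boundary E S = {e \<in> E. card (e \<inter> S) = 1}"

definition weight :: "('a set \<Rightarrow> real) \<Rightarrow> 'a set set \<Rightarrow> real" where
  "weight c A = (\<Prod>e\<in>A. c e)"

definition kappa :: "'a set \<Rightarrow> 'a set set \<Rightarrow> ('a set \<Rightarrow> real) \<Rightarrow> real" where
  "kappa V E c = (\<Sum>A\<in>spanning_trees V E. weight c A)"

definition kappa2 :: "'a set \<Rightarrow> 'a set set \<Rightarrow> ('a set \<Rightarrow> real) \<Rightarrow> real" where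
  "kappa2 V E c = (\<Sum>B\<in>two_forests V E. weight c B)"

definition forest_measure :: "'a set \<Rightarrow> 'a set set \<Rightarrow> ('a set \<Rightarrow> real) \<Rightarrow> 'a set set measure" where
  "forest_measure V E c =
     point_measure (two_forests V E) (\<lambda>B. ennreal (weight c B / kappa2 V E c))"

text \<open>For a two-component forest and \<open>b \<in> V\<close> exactly one component avoids \<open>b\<close>.\<close>

definition floating :: "'a set \<Rightarrow> 'a \<Rightarrow> 'a set set \<Rightarrow> 'a set" where
  "floating V b B = (THE S. S \<in> graph_components V B \<and> b \<notin> S)"

definition laplacian ::
    "'a set \<Rightarrow> 'a set set \<Rightarrow> ('a set \<Rightarrow> real) \<Rightarrow> ('a \<Rightarrow> real) \<Rightarrow> 'a \<Rightarrow> real" where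
  "laplacian V E c f v = (\<Sum>v'\<in>{v'\<in>V. {v, v'} \<in> E}. c {v, v'} * (f v - f v'))"

text \<open>The \<open>(u, v)\<close> entry of the matrix of the Laplacian: the value at \<open>u\<close> of the Laplacian
  applied to the basis vector at \<open>v\<close>. The Dirichlet Laplacian is this matrix restricted to
  row and column indices in \<open>V - {b}\<close>.\<close>

definition laplacian_matrix ::
    "'a set \<Rightarrow> 'a set set \<Rightarrow> ('a set \<Rightarrow> real) \<Rightarrow> 'a \<Rightarrow> 'a \<Rightarrow> real" where
  "laplacian_matrix V E c u v = laplacian V E c (\<lambda>w. if w = v then 1 else 0) u"

definition inverse_matrix_on :: "'a set \<Rightarrow> ('a \<Rightarrow> 'a \<Rightarrow> real) \<Rightarrow> ('a \<Rightarrow> 'a \<Rightarrow> real) \<Rightarrow> bool" where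
  "inverse_matrix_on I M N \<longleftrightarrow>
     (\<forall>u\<in>I. \<forall>v\<in>I. (\<Sum>w\<in>I. M u w * N w v) = (if u = v then 1 else 0)) \<and>
     (\<forall>u\<in>I. \<forall>v\<in>I. (\<Sum>w\<in>I. N u w * M w v) = (if u = v then 1 else 0))"

text \<open>The second conjunct is the extension by zero; it also makes the function unique, since
  the first one only constrains the entries with both indices in \<open>V - {b}\<close>.\<close>

definition green ::
    "'a set \<Rightarrow> 'a set set \<Rightarrow> ('a set \<Rightarrow> real) \<Rightarrow> 'a \<Rightarrow> 'a \<Rightarrow> 'a \<Rightarrow> real" where
  "green V E c b =
     (THE G. inverse_matrix_on (V - {b}) (laplacian_matrix V E c) G \<and>
             (\<forall>u v. u \<notin> V - {b} \<or> v \<notin> V - {b} \<longrightarrow> G u v = 0))"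

text \<open>The arguments are directed edges, given as pairs (tail, head).\<close>

fun transfer_current ::
    "'a set \<Rightarrow> 'a set set \<Rightarrow> ('a set \<Rightarrow> real) \<Rightarrow> 'a \<Rightarrow> 'a \<times> 'a \<Rightarrow> 'a \<times> 'a \<Rightarrow> real" where
  "transfer_current V E c b (u1, v1) (u2, v2) =
     c {u2, v2} * (green V E c b u1 u2 - green V E c b u1 v2
                   - green V E c b u2 v1 + green V E c b v1 v2)"

end

theory Submission
  imports Defs
begin

text \<open>For a two-component forest \<open>B\<close> let \<open>r\<^sub>B(z)\<close> be \<open>1\<close> if \<open>z\<close> lies in the floating component and \<open>0\<close>
  otherwise. The edge \<open>uv\<close> crosses the boundary of that component iff
  \<open>(r\<^sub>B(u) - r\<^sub>B(v))\<^sup>2 = 1\<close>. Expanding the square, the weight of the forests with this property is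
  \<open>N(u,u) - 2 N(u,v) + N(v,v)\<close>, where \<open>N(x,y)\<close> is the sum of \<open>w(B) r\<^sub>B(x) r\<^sub>B(y)\<close> over all \<open>B\<close>.
  The theorem is therefore the identity \<open>G = N / \<kappa>\<close> (lemma \<open>green_eq_forest_pairing\<close>). It is
  proved by checking that \<open>N / \<kappa>\<close> inverts the Dirichlet Laplacian, without determinants.

  The value at \<open>x\<close> of the Laplacian of \<open>N(\<cdot>,y)\<close> is a sum over neighbours \<open>x'\<close> of \<open>x\<close> and forests
  \<open>B\<close>, with terms \<open>c(xx') w(B) r\<^sub>B(y) (r\<^sub>B(x) - r\<^sub>B(x'))\<close>. A term vanishes unless \<open>x\<close> and \<open>x'\<close> lie in
  different components of \<open>B\<close>. Then \<open>A = B + xx'\<close> is a spanning tree of weight \<open>c(xx') w(B)\<close>, and every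
  spanning tree containing \<open>xx'\<close> arises exactly once (\<open>two_forests_insert_bij\<close>). For
  such a pair the remaining factor is linear in indicators: it equals
  \<open>[xx' separates x from b in A] - [xx' separates x from y in A]\<close> (\<open>off_root_difference\<close>).
  For a fixed tree \<open>A\<close> and any \<open>z \<noteq> x\<close> exactly one edge at \<open>x\<close> separates \<open>x\<close> from \<open>z\<close>, namely the first edge
  of the path to \<open>z\<close> (\<open>card_separating_neighbours\<close>). Summing over \<open>x'\<close> gives
  \<open>[x \<noteq> b] - [x \<noteq> y]\<close>, which is \<open>[x = y]\<close> as \<open>x \<noteq> b\<close>; summing over \<open>A\<close> gives \<open>\<kappa> [x = y]\<close>.\<close>

section \<open>Connectivity and bridges\<close>

abbreviation linked :: "'a set set \<Rightarrow> 'a \<Rightarrow> 'a \<Rightarrow> bool" where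
  "linked A u v \<equiv> (u, v) \<in> (adj A)\<^sup>*"

lemma edge_endpoints:
  assumes "simple_graph V E" "{x, y} \<in> E"
  shows "x \<in> V" "y \<in> V" "x \<noteq> y"
proof -
  have "{x, y} \<subseteq> V" "card {x, y} = 2" using assms unfolding simple_graph_def by blast+
  then show "x \<in> V" "y \<in> V" "x \<noteq> y" by auto
qed

lemma linked_sym: "linked A u v \<Longrightarrow> linked A v u"
proof -
  have "sym ((adj A)\<^sup>*)"
    by (rule sym_rtrancl) (auto simp: sym_def adj_def insert_commute)
  then show "linked A u v \<Longrightarrow> linked A v u" by (rule symD)
qed

lemma linked_trans: "linked A u v \<Longrightarrow> linked A v w \<Longrightarrow> linked A u w"
  by (rule rtrancl_trans)

lemma linked_edge: "{u, v} \<in> A \<Longrightarrow> linked A u v"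
  by (auto simp: adj_def)

lemma linked_mono: "linked A u v \<Longrightarrow> A \<subseteq> B \<Longrightarrow> linked B u v"
  using rtrancl_mono[of "adj A" "adj B"] by (auto simp: adj_def)

text \<open>A walk in the enlarged graph that uses the new edge can be cut before its first and after its
  last crossing; the three cases are: no net crossing, or a crossing in either direction.\<close>

lemma linked_insertD:
  assumes "linked (insert {x, y} B) p q"
  shows "linked B p q \<or> (linked B p x \<and> linked B y q) \<or> (linked B p y \<and> linked B x q)"
  using assms
proof (induction rule: rtrancl_induct)
  case base
  then show ?case by simp
next
  case (step q r)
  from step.hyps(2) have "{q, r} = {x, y} \<or> {q, r} \<in> B" by (auto simp: adj_def)
  then have "(q = x \<and> r = y) \<or> (q = y \<and> r = x) \<or> linked B q r"
    by (auto simp: doubleton_eq_iff linked_edge)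
  then show ?case
    using step.IH linked_trans[of _ _ B] linked_sym[of _ _ B] by blast
qed

lemma distinct_walk:
  assumes "(x, y) \<in> R\<^sup>*"
  obtains xs where "xs \<noteq> []" "hd xs = x" "last xs = y" "distinct xs"
    "successively (\<lambda>p q. (p, q) \<in> R) xs"
proof -
  have "\<exists>xs. xs \<noteq> [] \<and> hd xs = x \<and> last xs = y \<and> distinct xs
      \<and> successively (\<lambda>p q. (p, q) \<in> R) xs"
    using assms
  proof (induction rule: converse_rtrancl_induct)
    case base
    show ?case by (rule exI[of _ "[y]"]) simp
  next
    case (step x z)
    then obtain xs where xs: "xs \<noteq> []" "hd xs = z" "last xs = y" "distinct xs"
      "successively (\<lambda>p q. (p, q) \<in> R) xs" by blast
    show ?case
    proof (cases "x \<in> set xs")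
      case True
      then obtain ys zs where "xs = ys @ x # zs" by (meson split_list)
      with xs show ?thesis
        by (intro exI[of _ "x # zs"]) (auto simp: successively_append_iff)
    next
      case False
      with xs step.hyps show ?thesis
        by (intro exI[of _ "x # xs"]) (auto simp: successively_Cons)
    qed
  qed
  then show ?thesis using that by blast
qed

text \<open>Acyclicity is used in the form "every edge is a bridge", because adding and removing edges
  acts on reachability much more directly than on cyclic vertex lists. A walk around a deleted
  edge can be made non-repeating and is then closed to a cycle by that edge; conversely a cycle
  reaches both ends of its closing edge without using it.\<close>

lemma acyclic_edges_iff_bridges:
  "acyclic_edges A \<longleftrightarrow> (\<forall>x y. x \<noteq> y \<and> {x, y} \<in> A \<longrightarrow> \<not> linked (A - {{x, y}}) x y)"
proof
  assume acyc: "acyclic_edges A"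
  show "\<forall>x y. x \<noteq> y \<and> {x, y} \<in> A \<longrightarrow> \<not> linked (A - {{x, y}}) x y"
  proof (intro allI impI notI)
    fix x y assume xy: "x \<noteq> y \<and> {x, y} \<in> A" and l: "linked (A - {{x, y}}) x y"
    from l obtain xs where xs: "xs \<noteq> []" "hd xs = x" "last xs = y" "distinct xs"
      and walk: "successively (\<lambda>p q. (p, q) \<in> adj (A - {{x, y}})) xs"
      by (rule distinct_walk)
    have step: "{xs ! i, xs ! Suc i} \<in> A - {{x, y}}" if "Suc i < length xs" for i
      using walk that unfolding successively_conv_nth by (auto simp: adj_def)
    have x0: "xs ! 0 = x" and yn: "xs ! (length xs - 1) = y"
      using xs by (auto simp: hd_conv_nth last_conv_nth)
    \<comment> \<open>A walk with two vertices would be the deleted edge itself.\<close>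
    have "length xs \<noteq> 1" using x0 yn xy by auto
    moreover have "length xs \<noteq> 2" using step[of 0] x0 yn by auto
    ultimately have len: "length xs \<ge> 3" using xs(1) by (cases "length xs") auto
    have "{xs ! i, xs ! (Suc i mod length xs)} \<in> A" if "i < length xs" for i
    proof (cases "Suc i = length xs")
      case True
      then have "i = length xs - 1" by simp
      with yn have "xs ! i = y" by simp
      with True x0 xy show ?thesis by (simp add: insert_commute)
    next
      case False
      with that step[of i] show ?thesis by auto
    qed
    with len xs have "is_cycle A xs" by (simp add: is_cycle_def)
    with acyc show False by (auto simp: acyclic_edges_def)
  qed
next
  assume br: "\<forall>x y. x \<noteq> y \<and> {x, y} \<in> A \<longrightarrow> \<not> linked (A - {{x, y}}) x y"
  show "acyclic_edges A"
    unfolding acyclic_edges_def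
  proof
    assume "\<exists>xs. is_cycle A xs"
    then obtain xs where len: "length xs \<ge> 3" and dist: "distinct xs"
      and ed: "\<And>i. i < length xs \<Longrightarrow> {xs ! i, xs ! (Suc i mod length xs)} \<in> A"
      by (auto simp: is_cycle_def)
    define n where "n = length xs - 1"
    have n: "n \<ge> 2" "length xs = Suc n" using len by (auto simp: n_def)
    let ?x = "xs ! 0" and ?y = "xs ! n"
    have "linked (A - {{?x, ?y}}) ?x (xs ! i)" if "i \<le> n" for i
      using that
    proof (induction i)
      case 0
      show ?case by simp
    next
      case (Suc i)
      have "{xs ! i, xs ! Suc i} \<in> A" using ed[of i] Suc.prems n by simp
      moreover have "{xs ! i, xs ! Suc i} \<noteq> {?x, ?y}"
        using Suc.prems n dist by (auto simp: doubleton_eq_iff nth_eq_iff_index_eq)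
      ultimately have "linked (A - {{?x, ?y}}) (xs ! i) (xs ! Suc i)"
        by (intro linked_edge) simp
      with Suc show ?case by (meson Suc_leD linked_trans)
    qed
    then have "linked (A - {{?x, ?y}}) ?x ?y" by simp
    moreover have "?x \<noteq> ?y" using dist n by (auto simp: nth_eq_iff_index_eq)
    moreover have "{?x, ?y} \<in> A" using ed[of n] n by (simp add: insert_commute)
    ultimately show False using br by blast
  qed
qed

lemma acyclic_edges_subset: "acyclic_edges A \<Longrightarrow> B \<subseteq> A \<Longrightarrow> acyclic_edges B"
  by (auto simp: acyclic_edges_def is_cycle_def)

text \<open>The new edge is a bridge by hypothesis. If an old edge \<open>pq\<close> stopped being a bridge, the
  detour around it would use the new edge \<open>xy\<close>; replacing the detour's use of \<open>xy\<close> by \<open>pq\<close> would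
  then link \<open>x\<close> to \<open>y\<close> in the old graph.\<close>

lemma acyclic_edges_insert:
  assumes B: "acyclic_edges B" and xy: "\<not> linked B x y"
  shows "acyclic_edges (insert {x, y} B)"
  unfolding acyclic_edges_iff_bridges
proof (intro allI impI notI)
  fix p q
  assume pq: "p \<noteq> q \<and> {p, q} \<in> insert {x, y} B"
    and l: "linked (insert {x, y} B - {{p, q}}) p q"
  have notin: "{x, y} \<notin> B" using xy linked_edge by metis
  show False
  proof (cases "{p, q} = {x, y}")
    case True
    then have "linked B p q" using l notin by simp
    with True xy linked_sym show False by (metis doubleton_eq_iff)
  next
    case False
    let ?B = "B - {{p, q}}"
    have pqB: "{p, q} \<in> B" using pq False by simp
    have "insert {x, y} B - {{p, q}} = insert {x, y} ?B" using False by blast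
    with l have "linked (insert {x, y} ?B) p q" by simp
    then have "linked ?B p q \<or> (linked ?B p x \<and> linked ?B y q) \<or> (linked ?B p y \<and> linked ?B x q)"
      by (rule linked_insertD)
    moreover have "\<not> linked ?B p q" using B pq pqB by (simp add: acyclic_edges_iff_bridges)
    moreover have "linked ?B s t \<Longrightarrow> linked B s t" for s t by (rule linked_mono) auto
    ultimately have "(linked B p x \<and> linked B y q) \<or> (linked B p y \<and> linked B x q)" by blast
    moreover have "linked B p q" using pqB by (rule linked_edge)
    ultimately show False using xy linked_sym[of _ _ B] linked_trans[of _ _ B] by blast
  qed
qed

section \<open>Two-component forests and spanning trees\<close>

definition component :: "'a set \<Rightarrow> 'a set set \<Rightarrow> 'a \<Rightarrow> 'a set" where
  "component V A p = {z \<in> V. linked A p z}"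

lemma graph_components_eq: "graph_components V A = component V A ` V"
  by (auto simp: graph_components_def quotient_def component_def)

lemma component_eq_iff:
  assumes "p \<in> V" "q \<in> V"
  shows "component V A p = component V A q \<longleftrightarrow> linked A p q"
proof
  assume eq: "component V A p = component V A q"
  have "q \<in> component V A p" using assms unfolding eq by (simp add: component_def)
  then show "linked A p q" by (simp add: component_def)
next
  assume pq: "linked A p q"
  show "component V A p = component V A q"
    unfolding component_def using linked_trans[OF pq] linked_trans[OF linked_sym[OF pq]] by blast
qed

lemma card_graph_components_eq_2:
  assumes pq: "p \<in> V" "q \<in> V" "\<not> linked A p q"
    and cov: "\<And>z. z \<in> V \<Longrightarrow> linked A p z \<or> linked A q z"
  shows "card (graph_components V A) = 2"
proof -
  have "component V A p = component V A z \<or> component V A q = component V A z" if "z \<in> V" for z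
    using cov[OF that] that pq(1,2) by (simp add: component_eq_iff)
  then have "component V A ` V = {component V A p, component V A q}" using pq(1,2) by blast
  then show ?thesis using pq by (simp add: graph_components_eq component_eq_iff)
qed

text \<open>A third class, besides those of \<open>p\<close> and \<open>q\<close>, would contradict the count of components.\<close>

lemma linked_either:
  assumes card2: "card (graph_components V A) = 2"
    and V: "p \<in> V" "q \<in> V" "z \<in> V" and pq: "\<not> linked A p q"
  shows "linked A p z \<or> linked A q z"
proof (rule ccontr)
  assume neg: "\<not> ?thesis"
  let ?K = "component V A"
  have "card {?K p, ?K q, ?K z} = 3" using V pq neg by (simp add: component_eq_iff)
  moreover have "finite (?K ` V)"
    using card2 unfolding graph_components_eq by (metis card.infinite zero_neq_numeral)
  moreover have "{?K p, ?K q, ?K z} \<subseteq> ?K ` V" using V by simp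
  ultimately have "3 \<le> card (?K ` V)" by (metis card_mono)
  then show False using card2 by (simp only: graph_components_eq)
qed

text \<open>This replaces the definite description of the floating component by a pointwise condition,
  in which membership is non-reachability from the root.\<close>

lemma floating_eq:
  assumes card2: "card (graph_components V B) = 2" and b: "b \<in> V"
  shows "floating V b B = {z \<in> V. \<not> linked B b z}"
proof -
  let ?K = "component V B"
  have "\<exists>q\<in>V. \<not> linked B b q"
  proof (rule ccontr)
    assume "\<not> ?thesis"
    then have "?K b = ?K z" if "z \<in> V" for z
      using that b by (simp add: component_eq_iff)
    then have "?K ` V = {?K b}" using b by blast
    with card2 show False by (simp add: graph_components_eq)
  qed
  then obtain q where q: "q \<in> V" "\<not> linked B b q" by blast
  note either = linked_either[OF card2 b q(1) _ q(2)]
  have "floating V b B = ?K q"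
    unfolding floating_def graph_components_eq
  proof (rule the_equality)
    have "\<not> linked B q b" using q(2) by (metis linked_sym)
    then show "?K q \<in> ?K ` V \<and> b \<notin> ?K q" using q(1) by (simp add: component_def)
  next
    fix S assume "S \<in> ?K ` V \<and> b \<notin> S"
    then obtain z where z: "z \<in> V" "S = ?K z" "b \<notin> ?K z" by blast
    then have "\<not> linked B z b" using b by (simp add: component_def)
    then have "\<not> linked B b z" by (metis linked_sym)
    with either[OF z(1)] have "linked B q z" by blast
    then show "S = ?K q" using z q by (metis component_eq_iff)
  qed
  also have "\<dots> = {z \<in> V. \<not> linked B b z}"
  proof -
    have "linked B q z \<longleftrightarrow> \<not> linked B b z" if "z \<in> V" for z
      using either[OF that] q(2) by (meson linked_sym linked_trans)
    then show ?thesis by (auto simp: component_def)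
  qed
  finally show ?thesis .
qed

lemma spanning_tree_remove_edge:
  assumes A: "A \<in> spanning_trees V E" and f: "{x, y} \<in> A" and "x \<noteq> y"
  shows "\<not> linked (A - {{x, y}}) x y"
    and "\<And>z. z \<in> V \<Longrightarrow> x \<in> V \<Longrightarrow> linked (A - {{x, y}}) x z \<or> linked (A - {{x, y}}) y z"
proof -
  have acyc: "acyclic_edges A" and con: "graph_connected V A"
    using A by (auto simp: spanning_trees_def)
  show "\<not> linked (A - {{x, y}}) x y"
    using acyc f \<open>x \<noteq> y\<close> by (auto simp: acyclic_edges_iff_bridges)
  fix z assume "z \<in> V" "x \<in> V"
  with con have "linked A x z" by (simp add: graph_connected_def)
  moreover have "A = insert {x, y} (A - {{x, y}})" using f by blast
  ultimately have "linked (insert {x, y} (A - {{x, y}})) x z" by simp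
  from linked_insertD[OF this]
  show "linked (A - {{x, y}}) x z \<or> linked (A - {{x, y}}) y z" by blast
qed

text \<open>The exchange between forests and trees. An edge between the two components of a forest joins
  them into one without creating a cycle, and an edge of a tree is a bridge whose removal leaves
  exactly two components.\<close>

lemma two_forests_insert_bij:
  assumes xy: "x \<in> V" "y \<in> V" "x \<noteq> y" and f: "{x, y} \<in> E"
  shows "bij_betw (insert {x, y}) {B \<in> two_forests V E. \<not> linked B x y}
           {A \<in> spanning_trees V E. {x, y} \<in> A}"
proof (rule bij_betw_byWitness[where f' = "\<lambda>A. A - {{x, y}}"])
  have notin: "{x, y} \<notin> B" if "\<not> linked B x y" for B
    using that linked_edge by metis
  then show "\<forall>B\<in>{B \<in> two_forests V E. \<not> linked B x y}. insert {x, y} B - {{x, y}} = B" by simp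
  show "\<forall>A\<in>{A \<in> spanning_trees V E. {x, y} \<in> A}. insert {x, y} (A - {{x, y}}) = A" by auto
  show "insert {x, y} ` {B \<in> two_forests V E. \<not> linked B x y} \<subseteq> {A \<in> spanning_trees V E. {x, y} \<in> A}"
  proof clarify
    fix B assume B: "B \<in> two_forests V E" and n: "\<not> linked B x y"
    let ?A = "insert {x, y} B"
    have card2: "card (graph_components V B) = 2" using B by (simp add: two_forests_def)
    have "linked ?A x z" if "z \<in> V" for z
    proof -
      have "linked B x z \<or> linked B y z" using linked_either[OF card2 xy(1,2) that n] .
      then have "linked ?A x z \<or> linked ?A y z" using linked_mono[of _ _ B ?A] by blast
      moreover have "linked ?A x y" by (rule linked_edge) simp
      ultimately show ?thesis by (meson linked_trans)
    qed
    then have "graph_connected V ?A"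
      using xy linked_sym[of _ _ ?A] linked_trans[of _ _ ?A] unfolding graph_connected_def by blast
    moreover have "acyclic_edges ?A"
      using B n by (intro acyclic_edges_insert) (auto simp: two_forests_def)
    ultimately show "?A \<in> spanning_trees V E \<and> {x, y} \<in> ?A"
      using B f by (auto simp: spanning_trees_def two_forests_def)
  qed
  show "(\<lambda>A. A - {{x, y}}) ` {A \<in> spanning_trees V E. {x, y} \<in> A}
      \<subseteq> {B \<in> two_forests V E. \<not> linked B x y}"
  proof clarify
    fix A assume A: "A \<in> spanning_trees V E" and fA: "{x, y} \<in> A"
    note rem = spanning_tree_remove_edge[OF A fA xy(3)]
    have "card (graph_components V (A - {{x, y}})) = 2"
      using rem xy by (intro card_graph_components_eq_2[of x V y]) auto
    moreover have "acyclic_edges (A - {{x, y}})"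
      using A by (auto simp: spanning_trees_def intro: acyclic_edges_subset)
    ultimately show "A - {{x, y}} \<in> two_forests V E \<and> \<not> linked (A - {{x, y}}) x y"
      using A rem(1) by (auto simp: spanning_trees_def two_forests_def)
  qed
qed

text \<open>Leaving \<open>x\<close> for the last time: the rest of the walk uses no edge at \<open>x\<close>. In particular it
  survives the deletion of any such edge.\<close>

lemma first_step:
  assumes "linked A x z" "x \<noteq> z"
  obtains y where "{x, y} \<in> A" "linked {g \<in> A. x \<notin> g} y z"
proof -
  let ?A = "{g \<in> A. x \<notin> g}"
  have isolated: "\<not> linked ?A x z"
  proof
    assume "linked ?A x z"
    then show False using \<open>x \<noteq> z\<close> by (cases rule: converse_rtranclE) (auto simp: adj_def)
  qed
  have "linked ?A p z \<or> (\<exists>y. {x, y} \<in> A \<and> linked ?A y z)" if "linked A p z" for p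
    using that
  proof (induction rule: converse_rtrancl_induct)
    case base
    show ?case by simp
  next
    \<comment> \<open>Follow the walk backwards from \<open>z\<close> and record the first visit to \<open>x\<close>.\<close>
    case (step p q)
    have pq: "{p, q} \<in> A" using step.hyps(1) by (simp add: adj_def)
    show ?case
    proof (cases "linked ?A q z")
      case False
      then show ?thesis using step.IH by blast
    next
      case qz: True
      then have "q \<noteq> x" using isolated by auto
      show ?thesis
      proof (cases "p = x")
        case True
        then show ?thesis using pq qz by blast
      next
        case False
        then have "linked ?A p q" using pq \<open>q \<noteq> x\<close> by (intro linked_edge) simp
        then show ?thesis using linked_trans qz by (intro disjI1)
      qed
    qed
  qed
  then have "\<exists>y. {x, y} \<in> A \<and> linked ?A y z" using assms(1) isolated by blast
  then show ?thesis using that by blast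
qed

text \<open>The separating edge is the first edge of the tree path from \<open>x\<close> to \<open>z\<close>. It is a bridge with
  \<open>z\<close> on its far side, and deleting any other edge at \<open>x\<close> leaves the path intact.\<close>

lemma card_separating_neighbours:
  assumes sg: "simple_graph V E" and A: "A \<in> spanning_trees V E" and "x \<in> V" "z \<in> V"
  shows "card {y \<in> V. {x, y} \<in> A \<and> \<not> linked (A - {{x, y}}) x z} = (if z = x then 0 else 1)"
proof (cases "z = x")
  case True
  then show ?thesis by simp
next
  case False
  have AE: "A \<subseteq> E" and con: "graph_connected V A" using A by (auto simp: spanning_trees_def)
  have edge: "y \<in> V \<and> y \<noteq> x" if "{x, y} \<in> A" for y
    using edge_endpoints[OF sg, of x y] AE that by auto
  have "linked A x z" using con assms(3,4) by (simp add: graph_connected_def)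
  with False obtain y where y: "{x, y} \<in> A" and yz: "linked {g \<in> A. x \<notin> g} y z"
    by (metis first_step)
  have yz': "linked (A - {{x, y'}}) y z" for y'
    using yz by (rule linked_mono) auto
  have "{y' \<in> V. {x, y'} \<in> A \<and> \<not> linked (A - {{x, y'}}) x z} = {y}"
  proof (intro equalityI subsetI)
    fix y' assume "y' \<in> {y' \<in> V. {x, y'} \<in> A \<and> \<not> linked (A - {{x, y'}}) x z}"
    then have n: "\<not> linked (A - {{x, y'}}) x z" by simp
    show "y' \<in> {y}"
    proof (rule ccontr)
      assume "y' \<notin> {y}"
      then have "{x, y} \<in> A - {{x, y'}}" using y by (auto simp: doubleton_eq_iff)
      then have "linked (A - {{x, y'}}) x y" by (rule linked_edge)
      with yz'[of y'] n show False by (meson linked_trans)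
    qed
  next
    fix y' assume "y' \<in> {y}"
    moreover have "\<not> linked (A - {{x, y}}) x z"
    proof
      assume "linked (A - {{x, y}}) x z"
      then have "linked (A - {{x, y}}) x y" by (meson yz' linked_sym linked_trans)
      with spanning_tree_remove_edge(1)[OF A y] edge[OF y] show False by blast
    qed
    ultimately show "y' \<in> {y' \<in> V. {x, y'} \<in> A \<and> \<not> linked (A - {{x, y'}}) x z}"
      using y edge[OF y] by simp
  qed
  with False show ?thesis by simp
qed

lemma finite_edges: "simple_graph V E \<Longrightarrow> finite E"
  unfolding simple_graph_def by (auto intro: finite_subset[of E "Pow V"])

lemma finite_spanning_trees: "simple_graph V E \<Longrightarrow> finite (spanning_trees V E)"
  by (rule finite_subset[of _ "Pow E"]) (auto simp: spanning_trees_def finite_edges)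

lemma finite_two_forests: "simple_graph V E \<Longrightarrow> finite (two_forests V E)"
  by (rule finite_subset[of _ "Pow E"]) (auto simp: two_forests_def finite_edges)

text \<open>In a minimal connected edge set every edge is a bridge, since removing a non-bridge preserves
  connectedness.\<close>

lemma spanning_tree_exists:
  assumes sg: "simple_graph V E" and con: "graph_connected V E"
  shows "spanning_trees V E \<noteq> {}"
proof -
  let ?C = "{A. A \<subseteq> E \<and> graph_connected V A}"
  have "finite ?C" using finite_edges[OF sg] by simp
  moreover have "?C \<noteq> {}" using con by blast
  ultimately have "\<exists>A\<in>?C. \<forall>B\<in>?C. B \<subseteq> A \<longrightarrow> A = B" by (rule finite_has_minimal)
  then obtain A where A: "A \<subseteq> E" "graph_connected V A"
    and min: "\<And>B. B \<subseteq> E \<Longrightarrow> graph_connected V B \<Longrightarrow> B \<subseteq> A \<Longrightarrow> A = B" by auto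
  have "acyclic_edges A"
    unfolding acyclic_edges_iff_bridges
  proof (intro allI impI notI)
    fix x y assume xy: "x \<noteq> y \<and> {x, y} \<in> A" and l: "linked (A - {{x, y}}) x y"
    let ?B = "A - {{x, y}}"
    have "linked ?B p q" if "linked A p q" for p q
    proof -
      have "insert {x, y} ?B = A" using xy by blast
      then have "linked (insert {x, y} ?B) p q" using that by simp
      from linked_insertD[OF this] l show ?thesis
        using linked_sym[of _ _ ?B] linked_trans[of _ _ ?B] by blast
    qed
    then have "graph_connected V ?B" using A by (auto simp: graph_connected_def)
    then have "A = ?B" using A by (intro min) auto
    with xy show False by blast
  qed
  with A show ?thesis by (auto simp: spanning_trees_def)
qed

lemma kappa_pos:
  assumes sg: "simple_graph V E" and con: "graph_connected V E" and c: "\<forall>e'\<in>E. c e' > 0"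
  shows "kappa V E c > 0"
  unfolding kappa_def
proof (rule sum_pos)
  show "finite (spanning_trees V E)" by (rule finite_spanning_trees[OF sg])
  show "spanning_trees V E \<noteq> {}" by (rule spanning_tree_exists[OF sg con])
  show "0 < weight c A" if "A \<in> spanning_trees V E" for A
    unfolding weight_def by (rule prod_pos) (use that c in \<open>auto simp: spanning_trees_def\<close>)
qed

section \<open>The Green's function counts forests\<close>

text \<open>The indicator of the floating component, by \<open>floating_eq\<close>. It is stated through reachability
  because that is what adding or deleting a single edge controls.\<close>

definition off_root :: "'a \<Rightarrow> 'a set set \<Rightarrow> 'a \<Rightarrow> real" where
  "off_root b B z = of_bool (\<not> linked B b z)"

definition forest_pairing ::
    "'a set \<Rightarrow> 'a set set \<Rightarrow> ('a set \<Rightarrow> real) \<Rightarrow> 'a \<Rightarrow> 'a \<Rightarrow> 'a \<Rightarrow> real" where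
  "forest_pairing V E c b x y = (\<Sum>B\<in>two_forests V E. weight c B * off_root b B x * off_root b B y)"

lemma off_root_root [simp]: "off_root b B b = 0"
  by (simp add: off_root_def)

lemma forest_pairing_sym: "forest_pairing V E c b x y = forest_pairing V E c b y x"
  by (simp add: forest_pairing_def mult.assoc mult.commute[of "off_root b _ x"])

text \<open>The edge \<open>xx'\<close> splits \<open>A\<close> into the side of \<open>x\<close> and the side of \<open>x'\<close>. If \<open>b\<close> and \<open>y\<close> are on the
  same side then \<open>y\<close> is not floating and both sides of the equation vanish. Otherwise \<open>y\<close> is
  floating, and the sign records which of \<open>x\<close> and \<open>x'\<close> floats along with \<open>y\<close>.\<close>

lemma off_root_difference:
  assumes A: "A \<in> spanning_trees V E" and f: "{x, x'} \<in> A" and "x \<noteq> x'"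
    and V: "x \<in> V" "y \<in> V" "b \<in> V"
  defines "B \<equiv> A - {{x, x'}}"
  shows "off_root b B y * (off_root b B x - off_root b B x')
       = of_bool (\<not> linked B x b) - of_bool (\<not> linked B x y)"
proof -
  note rem = spanning_tree_remove_edge[OF A f \<open>x \<noteq> x'\<close>, folded B_def]
  have n: "\<not> linked B x x'" and b: "linked B x b \<or> linked B x' b" and y: "linked B x y \<or> linked B x' y"
    using rem V by auto
  have s: "linked B p q = linked B q p" for p q using linked_sym by metis
  note t = linked_trans[of _ _ B]
  show ?thesis
  proof (cases "linked B x b")
    case True
    then have "linked B b x" "\<not> linked B b x'" using n s t by blast+
    moreover have "linked B b y \<longleftrightarrow> linked B x y" using True s t by blast
    ultimately show ?thesis using True by (simp add: off_root_def)
  next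
    case False
    with b have b': "linked B b x'" using s by blast
    moreover have "\<not> linked B b x" using False s by blast
    moreover have "linked B b y \<longleftrightarrow> \<not> linked B x y" using b' y n s t by blast
    ultimately show ?thesis using False by (simp add: off_root_def)
  qed
qed

text \<open>The forests that do not separate \<open>x\<close> from \<open>x'\<close> contribute nothing to the difference; for the
  others the conductance is absorbed into the weight of the tree obtained by adding \<open>xx'\<close>.\<close>

lemma forest_pairing_difference:
  assumes sg: "simple_graph V E" and f: "{x, x'} \<in> E" and "y \<in> V" "b \<in> V"
  shows "c {x, x'} * (forest_pairing V E c b x y - forest_pairing V E c b x' y)
     = (\<Sum>A | A \<in> spanning_trees V E \<and> {x, x'} \<in> A. weight c A *
          (of_bool (\<not> linked (A - {{x, x'}}) x b) - of_bool (\<not> linked (A - {{x, x'}}) x y)))"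
proof -
  have xV: "x \<in> V" "x' \<in> V" and ne: "x \<noteq> x'"
    using edge_endpoints[OF sg f] by auto
  let ?h = "\<lambda>B. off_root b B y * (off_root b B x - off_root b B x')"
  let ?f = "{x, x'}"
  have finF: "finite (two_forests V E)" by (rule finite_two_forests[OF sg])
  have "c ?f * (forest_pairing V E c b x y - forest_pairing V E c b x' y)
      = (\<Sum>B\<in>two_forests V E. c ?f * weight c B * ?h B)"
    by (simp add: forest_pairing_def sum_subtractf[symmetric] sum_distrib_left algebra_simps)
  also have "\<dots> = (\<Sum>B | B \<in> two_forests V E \<and> \<not> linked B x x'. c ?f * weight c B * ?h B)"
  proof (rule sum.mono_neutral_right[OF finF])
    show "\<forall>B\<in>two_forests V E - {B \<in> two_forests V E. \<not> linked B x x'}. c ?f * weight c B * ?h B = 0"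
    proof
      fix B assume "B \<in> two_forests V E - {B \<in> two_forests V E. \<not> linked B x x'}"
      then have l: "linked B x x'" by simp
      then have "linked B b x \<longleftrightarrow> linked B b x'" by (meson linked_sym linked_trans)
      then show "c ?f * weight c B * ?h B = 0" by (simp add: off_root_def)
    qed
  qed auto
  also have "\<dots> = (\<Sum>B | B \<in> two_forests V E \<and> \<not> linked B x x'.
      weight c (insert ?f B) * ?h (insert ?f B - {?f}))"
  proof (rule sum.cong[OF refl])
    fix B assume "B \<in> {B \<in> two_forests V E. \<not> linked B x x'}"
    then have B: "B \<subseteq> E" and "?f \<notin> B"
      using linked_edge[of x x' B] by (auto simp: two_forests_def)
    moreover have "finite B" using B finite_edges[OF sg] finite_subset by blast
    ultimately show "c ?f * weight c B * ?h B = weight c (insert ?f B) * ?h (insert ?f B - {?f})"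
      by (simp add: weight_def)
  qed
  also have "\<dots> = (\<Sum>A | A \<in> spanning_trees V E \<and> ?f \<in> A. weight c A * ?h (A - {?f}))"
    by (rule sum.reindex_bij_betw[OF two_forests_insert_bij[OF xV ne f]])
  also have "\<dots> = (\<Sum>A | A \<in> spanning_trees V E \<and> ?f \<in> A. weight c A *
      (of_bool (\<not> linked (A - {?f}) x b) - of_bool (\<not> linked (A - {?f}) x y)))"
    using off_root_difference[OF _ _ ne xV(1) assms(3,4)]
    by (intro sum.cong refl arg_cong2[of _ _ _ _ "(*)"]) blast
  finally show ?thesis .
qed

text \<open>After exchanging the sums over neighbours and trees, each tree \<open>A\<close> contributes its weight times
  the number of edges at \<open>x\<close> separating \<open>x\<close> from \<open>b\<close>, minus the number of those separating \<open>x\<close>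
  from \<open>y\<close>. These numbers are \<open>1\<close> and \<open>[y \<noteq> x]\<close>.\<close>

lemma laplacian_forest_pairing:
  assumes sg: "simple_graph V E" and "x \<in> V" "y \<in> V" "b \<in> V" "x \<noteq> b"
  shows "laplacian V E c (\<lambda>z. forest_pairing V E c b z y) x = (if x = y then kappa V E c else 0)"
proof -
  have finV: "finite V" using sg by (simp add: simple_graph_def)
  let ?T = "spanning_trees V E"
  let ?g = "\<lambda>x' A. of_bool (\<not> linked (A - {{x, x'}}) x b) - of_bool (\<not> linked (A - {{x, x'}}) x y) :: real"
  have count: "(\<Sum>x' | x' \<in> V \<and> {x, x'} \<in> A. of_bool (\<not> linked (A - {{x, x'}}) x z)) = (of_bool (z \<noteq> x) :: real)"
    if "A \<in> ?T" "z \<in> V" for A z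
  proof -
    have "(\<Sum>x' | x' \<in> V \<and> {x, x'} \<in> A. of_bool (\<not> linked (A - {{x, x'}}) x z))
        = real (card ({x' \<in> V. {x, x'} \<in> A} \<inter> {x'. \<not> linked (A - {{x, x'}}) x z}))"
      using finV by (subst sum_of_bool_eq) auto
    also have "{x' \<in> V. {x, x'} \<in> A} \<inter> {x'. \<not> linked (A - {{x, x'}}) x z}
        = {x' \<in> V. {x, x'} \<in> A \<and> \<not> linked (A - {{x, x'}}) x z}" by blast
    finally show ?thesis
      using card_separating_neighbours[OF sg that(1) \<open>x \<in> V\<close> that(2)] by auto
  qed
  have "laplacian V E c (\<lambda>z. forest_pairing V E c b z y) x
      = (\<Sum>x' | x' \<in> V \<and> {x, x'} \<in> E. \<Sum>A | A \<in> ?T \<and> {x, x'} \<in> A. weight c A * ?g x' A)"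
    unfolding laplacian_def
    by (rule sum.cong[OF refl]) (use forest_pairing_difference[OF sg _ assms(3,4)] in auto)
  also have "\<dots> = (\<Sum>A\<in>?T. \<Sum>x' | x' \<in> {x' \<in> V. {x, x'} \<in> E} \<and> {x, x'} \<in> A. weight c A * ?g x' A)"
    using sum.swap_restrict[of "{x' \<in> V. {x, x'} \<in> E}" ?T "\<lambda>x' A. weight c A * ?g x' A" "\<lambda>x' A. {x, x'} \<in> A"]
      finV finite_spanning_trees[OF sg] by simp
  also have "\<dots> = (\<Sum>A\<in>?T. weight c A * (\<Sum>x' | x' \<in> V \<and> {x, x'} \<in> A. ?g x' A))"
    by (rule sum.cong[OF refl], subst sum_distrib_left, rule sum.cong) (auto simp: spanning_trees_def)
  also have "\<dots> = (\<Sum>A\<in>?T. weight c A * (of_bool (b \<noteq> x) - of_bool (y \<noteq> x)))"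
    by (rule sum.cong[OF refl]) (simp only: sum_subtractf count assms(3,4))
  also have "\<dots> = (if x = y then kappa V E c else 0)"
    using \<open>x \<noteq> b\<close> by (auto simp: kappa_def)
  finally show ?thesis .
qed

text \<open>For functions vanishing at the root, the Dirichlet matrix acts as the Laplacian of the whole
  graph: the deleted column would be multiplied by zero.\<close>

lemma laplacian_matrix_apply:
  assumes "finite V" "f b = 0" "x \<in> V"
  shows "(\<Sum>w\<in>V - {b}. laplacian_matrix V E c x w * f w) = laplacian V E c f x"
proof -
  let ?N = "{v'\<in>V. {x, v'} \<in> E}"
  have delta: "(\<Sum>w\<in>V - {b}. (if z = w then 1 else 0) * f w) = f z" if "z \<in> V" for z
    using assms that by (auto simp: if_distrib[of "\<lambda>t. t * _"] sum.delta cong: if_cong)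
  have "(\<Sum>w\<in>V - {b}. laplacian_matrix V E c x w * f w)
      = (\<Sum>v'\<in>?N. c {x, v'} * ((\<Sum>w\<in>V - {b}. (if x = w then 1 else 0) * f w)
            - (\<Sum>w\<in>V - {b}. (if v' = w then 1 else 0) * f w)))"
    unfolding laplacian_matrix_def laplacian_def sum_distrib_right sum_subtractf[symmetric]
      sum_distrib_left
    by (subst sum.swap) (simp add: algebra_simps)
  also have "\<dots> = laplacian V E c f x"
    unfolding laplacian_def by (intro sum.cong) (simp_all add: delta \<open>x \<in> V\<close>)
  finally show ?thesis .
qed

lemma laplacian_matrix_sym:
  assumes "finite V" "u \<in> V" "v \<in> V"
  shows "laplacian_matrix V E c u v = laplacian_matrix V E c v u"
proof (cases "u = v")
  case False
  have "laplacian_matrix V E c u v = (if {u, v} \<in> E then - c {u, v} else 0)"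
    if "u \<noteq> v" "v \<in> V" for u v
  proof -
    have "laplacian_matrix V E c u v
        = (\<Sum>v'\<in>{v'\<in>V. {u, v'} \<in> E}. if v' = v then - c {u, v} else 0)"
      unfolding laplacian_matrix_def laplacian_def using that by (intro sum.cong) auto
    also have "\<dots> = (if {u, v} \<in> E then - c {u, v} else 0)" using assms that by (simp add: sum.delta)
    finally show ?thesis .
  qed
  from this[of u v] this[of v u] show ?thesis using False assms by (simp add: insert_commute)
qed simp

lemma inverse_matrix_on_unique:
  assumes fin: "finite I" and G: "inverse_matrix_on I M G" and H: "inverse_matrix_on I M H"
    and uv: "u \<in> I" "v \<in> I"
  shows "G u v = H u v"
proof -
  have "G u v = (\<Sum>w\<in>I. G u w * (if w = v then 1 else 0))"
    using fin uv by (simp add: if_distrib[of "\<lambda>t. _ * t"] cong: if_cong)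
  also have "\<dots> = (\<Sum>w\<in>I. G u w * (\<Sum>z\<in>I. M w z * H z v))"
    using H uv by (intro sum.cong) (auto simp: inverse_matrix_on_def)
  also have "\<dots> = (\<Sum>z\<in>I. (\<Sum>w\<in>I. G u w * M w z) * H z v)"
    unfolding sum_distrib_left sum_distrib_right by (subst sum.swap) (simp add: mult.assoc)
  also have "\<dots> = (\<Sum>z\<in>I. (if u = z then 1 else 0) * H z v)"
    using G uv by (intro sum.cong) (auto simp: inverse_matrix_on_def)
  also have "\<dots> = H u v"
    using fin uv by (simp add: if_distrib[of "\<lambda>t. t * _"] cong: if_cong)
  finally show ?thesis .
qed

text \<open>Only one of the two inverse relations needs the forest sums; the other follows by transposition,
  since both matrices are symmetric. At the root both functions vanish, so the identity extends
  to all pairs of vertices.\<close>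

lemma green_eq_forest_pairing:
  assumes sg: "simple_graph V E" and con: "graph_connected V E" and c: "\<forall>e'\<in>E. c e' > 0"
    and "b \<in> V" and xy: "x \<in> V" "y \<in> V"
  shows "green V E c b x y = forest_pairing V E c b x y / kappa V E c"
proof -
  let ?I = "V - {b}" and ?L = "laplacian_matrix V E c" and ?k = "kappa V E c"
  define H where "H u v = (if u \<in> ?I \<and> v \<in> ?I then forest_pairing V E c b u v / ?k else 0)" for u v
  have finV: "finite V" using sg by (simp add: simple_graph_def)
  have k: "?k > 0" by (rule kappa_pos[OF sg con c])
  have right: "(\<Sum>w\<in>?I. ?L u w * H w v) = (if u = v then 1 else 0)" if uv: "u \<in> ?I" "v \<in> ?I" for u v
  proof -
    have "(\<Sum>w\<in>?I. ?L u w * H w v) = (\<Sum>w\<in>?I. ?L u w * forest_pairing V E c b w v) / ?k"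
      using uv by (simp add: H_def sum_divide_distrib)
    also have "(\<Sum>w\<in>?I. ?L u w * forest_pairing V E c b w v)
        = laplacian V E c (\<lambda>z. forest_pairing V E c b z v) u"
      using uv by (intro laplacian_matrix_apply[OF finV]) (simp_all add: forest_pairing_def)
    also have "\<dots> / ?k = (if u = v then 1 else 0)"
      using laplacian_forest_pairing[OF sg, of u v b c] uv \<open>b \<in> V\<close> k by auto
    finally show ?thesis .
  qed
  have left: "(\<Sum>w\<in>?I. H u w * ?L w v) = (if u = v then 1 else 0)" if uv: "u \<in> ?I" "v \<in> ?I" for u v
  proof -
    have "(\<Sum>w\<in>?I. H u w * ?L w v) = (\<Sum>w\<in>?I. ?L v w * H w u)"
      using uv laplacian_matrix_sym[OF finV]
      by (intro sum.cong) (auto simp: H_def forest_pairing_sym[of V E c b u])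
    also have "\<dots> = (if u = v then 1 else 0)" using right[OF uv(2,1)] by auto
    finally show ?thesis .
  qed
  have inv: "inverse_matrix_on ?I ?L H" using left right by (simp add: inverse_matrix_on_def)
  have "green V E c b = H"
    unfolding green_def
  proof (rule the_equality)
    show "inverse_matrix_on ?I ?L H \<and> (\<forall>u v. u \<notin> ?I \<or> v \<notin> ?I \<longrightarrow> H u v = 0)"
      using inv by (simp add: H_def)
    fix G assume G: "inverse_matrix_on ?I ?L G \<and> (\<forall>u v. u \<notin> ?I \<or> v \<notin> ?I \<longrightarrow> G u v = 0)"
    show "G = H"
    proof (intro ext)
      fix u v
      show "G u v = H u v"
        using G inverse_matrix_on_unique[OF _ _ inv, of G u v] finV
        by (cases "u \<in> ?I \<and> v \<in> ?I") (auto simp: H_def)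
    qed
  qed
  then show ?thesis using xy by (auto simp: H_def forest_pairing_def)
qed

section \<open>The boundary probability\<close>

theorem theorem4:
  fixes V :: "'a set" and E :: "'a set set" and c :: "'a set \<Rightarrow> real" and b :: 'a
    and e :: "'a set" and u v :: 'a
  assumes "simple_graph V E"
    and "graph_connected V E"
    and "card V \<ge> 2"
    and "\<forall>e'\<in>E. c e' > 0"
    and "b \<in> V"
    and "e \<in> E"
    and "e = {u, v}"
  shows "\<P>(B in forest_measure V E c. e \<in> edge_boundary E (floating V b B)) =
           kappa V E c * transfer_current V E c b (u, v) (u, v) / (c e * kappa2 V E c)"
proof -
  let ?F = "two_forests V E" and ?k = "kappa V E c" and ?k2 = "kappa2 V E c"
  let ?N = "forest_pairing V E c b"
  have uv: "u \<in> V" "v \<in> V" "u \<noteq> v"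
    using edge_endpoints[OF assms(1), of u v] assms(6,7) by auto
  have finF: "finite ?F" by (rule finite_two_forests[OF assms(1)])
  have w: "weight c B > 0" if "B \<in> ?F" for B
    unfolding weight_def by (rule prod_pos) (use that assms(4) in \<open>auto simp: two_forests_def\<close>)
  then have k2: "?k2 \<ge> 0" unfolding kappa2_def by (intro sum_nonneg) (simp add: less_imp_le)
  have k: "?k > 0" by (rule kappa_pos[OF assms(1,2,4)])
  have ce: "c e > 0" using assms(4,6) by simp
  let ?ev = "\<lambda>B. e \<in> edge_boundary E (floating V b B)"
  \<comment> \<open>The edge crosses the boundary iff exactly one of its ends floats.\<close>
  have ev: "of_bool (?ev B) = (off_root b B u - off_root b B v)\<^sup>2" if "B \<in> ?F" for B
  proof -
    have S: "floating V b B = {z \<in> V. \<not> linked B b z}"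
      using that assms(5) by (intro floating_eq) (simp_all add: two_forests_def)
    have "e \<inter> floating V b B = (if linked B b u then {} else {u}) \<union> (if linked B b v then {} else {v})"
      using uv assms(7) unfolding S by auto
    then show ?thesis
      using uv assms(6) by (auto simp: edge_boundary_def off_root_def)
  qed
  have "\<P>(B in forest_measure V E c. ?ev B) = (\<Sum>B | B \<in> ?F \<and> ?ev B. weight c B / ?k2)"
    unfolding forest_measure_def space_point_measure
    using finF w k2 by (subst measure_point_measure_finite_if) (auto simp: less_imp_le)
  also have "\<dots> = (\<Sum>B\<in>?F. of_bool (?ev B) * (weight c B / ?k2))"
    by (rule sum.mono_neutral_cong_left[OF finF]) auto
  also have "\<dots> = (\<Sum>B\<in>?F. weight c B * (off_root b B u - off_root b B v)\<^sup>2) / ?k2"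
    unfolding sum_divide_distrib by (rule sum.cong) (simp_all add: ev)
  also have "(\<Sum>B\<in>?F. weight c B * (off_root b B u - off_root b B v)\<^sup>2)
      = ?N u u - ?N u v - ?N u v + ?N v v"
    by (simp add: forest_pairing_def sum_subtractf[symmetric] sum.distrib[symmetric]
        power2_eq_square algebra_simps)
  also have "\<dots> = ?k * (?N u u / ?k - ?N u v / ?k - ?N u v / ?k + ?N v v / ?k)"
    using k by (simp add: field_simps)
  also have "\<dots> = ?k * transfer_current V E c b (u, v) (u, v) / c e"
    using ce uv assms(7) green_eq_forest_pairing[OF assms(1,2,4,5)] by simp
  finally show ?thesis by simp
qed

end
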